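(* Let $n\ge1$ be an integer, $\lambda\in(0,1]$, $0\le a<b$. For $r\in[a,b]$, the worst-case $\lambda$-regret of the second-price auction with fixed reserve $r$ is $$\sup_{\mathbf F\in\mathcal F_{\rm iid}}R_\lambda(\mathrm{SPA}(r),\mathbf F)=\begin{cases}-(1-\lambda)b+(b-a)\left(\frac{n-1}{n-1+\lambda}\right)^{n-1}&\text{if } r=a,\\ -(1-\lambda)b+\dfrac{(b-r)^n(n-1)^{n-1}}{((n-1+\lambda)(b-r)-r)^{n-1}}&\text{if } a<r\le\frac{\lambda}{1+\lambda}b,\\ \lambda r&\text{if } r>a,\ \frac{\lambda}{1+\lambda}b\le r\le b.\end{cases}$$ Consequently $$\inf_{r\in[a,b]}\sup_{\mathbf F\in\mathcal F_{\rm iid}}R_\lambda(\mathrm{SPA}(r),\mathbf F)=\begin{cases}-(1-\lambda)b+\left(\frac{n}{n+\lambda}\right)^nb&\text{if }\frac ab\le 1-\left(\frac{n}{n+\lambda}\right)^n\left(\frac{n-1+\lambda}{n-1}\right)^{n-1},\\ -(1-\lambda)b+\left(\frac{n-1}{n-1+\lambda}\right)^{n-1}(b-a)&\text{if }\frac ab\ge 1-\left(\frac{n}{n+\lambda}\right)^n\left(\frac{n-1+\lambda}{n-1}\right)^{n-1}.\end{cases}$$ An optimal $r$ in the first case is $r=\frac{\lambda}{n+\lambda}b$, and an optimal $r$ in the second case is $r=a$. For $n=1$, every term with exponent $n-1$ is interpreted as $1$.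
   Context: A seller sells one item to $n$ buyers with valuations $\mathbf v\in[a,b]^n$. $\mathcal F_{\rm iid}$ is the class of product distributions $\prod_iF(v_i)$ with $F$ an arbitrary probability distribution supported in $[a,b]$. For a mechanism $m$ with payment rule $\mathbf p$, $R_\lambda(m,\mathbf F)=\mathbb E_{\mathbf v\sim\mathbf F}[\lambda\max(\mathbf v)-\sum_ip_i(\mathbf v)]$. $\mathrm{SPA}(r)$: with $v^{(1)}\ge v^{(2)}$ the highest and second-highest entries of $\mathbf v$ (for $n=1$ set $v^{(2)}=a$), if $v^{(1)}\ge r$ a highest bidder (ties broken uniformly) gets the item and pays $\max(v^{(2)},r)$; if $v^{(1)}<r$ there is no sale and no payment. $\mathrm{SPA}(a)$ is the second-price auction without reserve. *)

theory Defs
  imports "HOL-Probability.Probability"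
begin

text \<open>
  A valuation profile of \<open>n\<close> buyers is a function \<open>v :: nat \<Rightarrow> real\<close>, of which only the
  entries \<open>v i\<close> with \<open>i < n\<close> matter.  A mechanism consists of the winning probabilities
  and the (expected) payments of the buyers.
\<close>

record mechanism =
  alloc :: "(nat \<Rightarrow> real) \<Rightarrow> nat \<Rightarrow> real"
  payment :: "(nat \<Rightarrow> real) \<Rightarrow> nat \<Rightarrow> real"

definition dists_on :: "real \<Rightarrow> real \<Rightarrow> real measure set" where
  "dists_on a b = {F. prob_space F \<and> sets F = sets borel \<and> emeasure F {a..b} = 1}"

definition iid_class :: "nat \<Rightarrow> real \<Rightarrow> real \<Rightarrow> (nat \<Rightarrow> real) measure set" where
  "iid_class n a b = (\<lambda>F. Pi\<^sub>M {..<n} (\<lambda>_. F)) ` dists_on a b"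

definition highest :: "nat \<Rightarrow> (nat \<Rightarrow> real) \<Rightarrow> real" where
  "highest n v = Max (v ` {..<n})"

text \<open>Entries are counted with multiplicity: if the highest entry is attained twice,
  the second-highest entry equals it.\<close>

definition second_highest :: "real \<Rightarrow> nat \<Rightarrow> (nat \<Rightarrow> real) \<Rightarrow> real" where
  "second_highest a n v = (if n = 1 then a else rev (sort (map v [0..<n])) ! 1)"

definition highest_bidders :: "nat \<Rightarrow> (nat \<Rightarrow> real) \<Rightarrow> nat set" where
  "highest_bidders n v = {i. i < n \<and> v i = highest n v}"

definition spa_alloc :: "nat \<Rightarrow> real \<Rightarrow> (nat \<Rightarrow> real) \<Rightarrow> nat \<Rightarrow> real" where
  "spa_alloc n r v i =
     (if highest n v \<ge> r \<and> i \<in> highest_bidders n v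
      then 1 / real (card (highest_bidders n v)) else 0)"

text \<open>The winner pays \<open>max v\<^sup>(\<^sup>2\<^sup>) r\<close>; with ties broken uniformly, the payment of a buyer in
  expectation over the tie-breaking is this price times the winning probability.\<close>

definition SPA :: "real \<Rightarrow> nat \<Rightarrow> real \<Rightarrow> mechanism" where
  "SPA a n r =
     \<lparr>alloc = spa_alloc n r,
      payment = (\<lambda>v i. spa_alloc n r v i * max (second_highest a n v) r)\<rparr>"

definition regret :: "nat \<Rightarrow> real \<Rightarrow> mechanism \<Rightarrow> (nat \<Rightarrow> real) measure \<Rightarrow> real" where
  "regret n lam m FF = (\<integral>v. lam * highest n v - (\<Sum>i<n. payment m v i) \<partial>FF)"

text \<open>The supremum is taken in the extended reals, so that it is meaningful without a
  separate boundedness claim.\<close>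

definition worst_regret :: "nat \<Rightarrow> real \<Rightarrow> real \<Rightarrow> real \<Rightarrow> mechanism \<Rightarrow> ereal" where
  "worst_regret n a b lam m = (SUP FF \<in> iid_class n a b. ereal (regret n lam m FF))"

end

theory Submission
  imports Defs
begin

text \<open>
  Write \<open>F t\<close> for the distribution function and \<open>q = F(r-)\<close>.  Integrating the tails of the two
  highest valuations expresses the regret of \<open>SPA(r)\<close> as an integral over \<open>t \<in> [a, b)\<close>
  whose integrand depends only on \<open>F t\<close> and whose remaining term depends only on \<open>q\<close>.
  Below \<open>r\<close> the integrand is largest for \<open>F t = 0\<close>; above \<open>r\<close>, where \<open>q \<le> F t\<close>, it is
  bounded by the maximum of a polynomial \<open>n c z\<^sup>n\<^sup>-\<^sup>1 - D z\<^sup>n\<close> over \<open>z \<in> [0, 1]\<close>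
  (for \<open>r > a\<close>, \<open>c = b - r\<close> and \<open>D = (n - 1 + lam) (b - r) - r\<close>),
  which the weighted AM-GM inequality evaluates.
  Mass \<open>z\<close> slightly below \<open>r\<close> (at \<open>a\<close> if \<open>r = a\<close>) and \<open>1 - z\<close> at \<open>b\<close> approaches the bound.
  At \<open>z = n / (n + lam)\<close> this polynomial does not depend on \<open>r\<close>, so its value there bounds
  the worst-case regret of every reserve \<open>r > a\<close> from below; the bound is attained at
  \<open>r = lam b / (n + lam)\<close>, and the threshold on \<open>a / b\<close> compares it with the value at \<open>r = a\<close>.
\<close>

text \<open>Replaces calculus: with \<open>y\<close> at a stationary point, or at 1, it bounds the
  polynomials maximised below.\<close>

lemma weighted_AM_GM:
  fixes x y :: real
  assumes "x \<ge> 0" "y \<ge> 0"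
  shows "real (Suc m) * x ^ m * y \<le> real m * x ^ Suc m + y ^ Suc m"
proof (induction m)
  case 0
  then show ?case by simp
next
  case (Suc m)
  \<comment> \<open>Adding this to \<open>y\<close> times the induction hypothesis gives the next
    case; the terms in \<open>x ^ m * y ^ 2\<close> cancel.\<close>
  have "0 \<le> (real m + 1) * x ^ m * (x - y)\<^sup>2"
    using assms by simp
  moreover have "(real (Suc m) * x ^ m * y) * y \<le> (real m * x ^ Suc m + y ^ Suc m) * y"
    using Suc assms by (intro mult_right_mono)
  ultimately show ?case
    by (simp add: algebra_simps power2_eq_square)
qed

section \<open>Order statistics and revenue for a fixed profile\<close>

text \<open>Sorting preserves the number of entries above \<open>t\<close>, and a sorted list has
  two such entries exactly when its last but one entry, at index \<open>n - 2\<close>, is one of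
  them.\<close>

lemma less_second_highest_iff:
  assumes "n \<ge> 2"
  shows "t < second_highest a n v \<longleftrightarrow> (\<exists>i<n. \<exists>j<n. i \<noteq> j \<and> t < v i \<and> t < v j)"
proof -
  define xs where "xs = sort (map v [0..<n])"
  have len: "length xs = n" and sorted: "sorted xs"
    by (simp_all add: xs_def)
  have second: "second_highest a n v = xs ! (n - 2)"
    using assms len by (simp add: second_highest_def xs_def[symmetric] rev_nth numeral_2_eq_2)
  have "card {i. i < n \<and> t < xs ! i} = length (filter ((<) t) xs)"
    by (simp add: length_filter_conv_card len)
  also have "\<dots> = length (filter ((<) t) (map v [0..<n]))"
    by (metis mset_filter mset_sort size_mset xs_def)
  also have "\<dots> = card {i. i < n \<and> t < v i}"
    by (subst length_filter_conv_card) (auto intro!: arg_cong[where f = card])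
  finally have card_eq: "card {i. i < n \<and> t < xs ! i} = card {i. i < n \<and> t < v i}" .
  have "t < xs ! (n - 2) \<longleftrightarrow> card {i. i < n \<and> t < xs ! i} \<ge> 2"
  proof
    assume less: "t < xs ! (n - 2)"
    moreover have "xs ! (n - 2) \<le> xs ! (n - 1)"
      using sorted assms len by (intro sorted_nth_mono) auto
    ultimately have "{n - 2, n - 1} \<subseteq> {i. i < n \<and> t < xs ! i}"
      using assms by auto
    then have "card {n - 2, n - 1} \<le> card {i. i < n \<and> t < xs ! i}"
      by (intro card_mono) auto
    then show "card {i. i < n \<and> t < xs ! i} \<ge> 2"
      using assms by (simp add: card_insert_if split: if_splits)
  next
    assume two: "card {i. i < n \<and> t < xs ! i} \<ge> 2"
    show "t < xs ! (n - 2)"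
    proof (rule ccontr)
      assume not_less: "\<not> t < xs ! (n - 2)"
      have "i = n - 1" if "i < n" "t < xs ! i" for i
      proof (rule ccontr)
        assume "i \<noteq> n - 1"
        then have "xs ! i \<le> xs ! (n - 2)"
          using sorted len that by (intro sorted_nth_mono) auto
        then show False using not_less that by simp
      qed
      then have "{i. i < n \<and> t < xs ! i} \<subseteq> {n - 1}" by blast
      then have "card {i. i < n \<and> t < xs ! i} \<le> 1"
        using card_mono[of "{n - 1}"] by simp
      then show False using two by simp
    qed
  qed
  also have "\<dots> \<longleftrightarrow> (\<exists>i<n. \<exists>j<n. i \<noteq> j \<and> t < v i \<and> t < v j)"
    using card_le_Suc0_iff_eq[of "{i. i < n \<and> t < v i}"]
    unfolding card_eq numeral_2_eq_2 not_less_eq_eq[symmetric] by auto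
  finally show ?thesis by (simp add: second)
qed

lemma highest_le_iff:
  assumes "n \<ge> 1"
  shows "highest n v \<le> t \<longleftrightarrow> (\<forall>i<n. v i \<le> t)"
  unfolding highest_def using assms by (subst Max_le_iff) (auto simp: lessThan_empty_iff)

lemma highest_less_iff:
  assumes "n \<ge> 1"
  shows "highest n v < t \<longleftrightarrow> (\<forall>i<n. v i < t)"
  unfolding highest_def using assms by (subst Max_less_iff) (auto simp: lessThan_empty_iff)

lemma highest_bidders_nonempty:
  assumes "n \<ge> 1"
  shows "card (highest_bidders n v) > 0"
proof -
  have "highest n v \<in> v ` {..<n}"
    unfolding highest_def using assms by (intro Max_in) (auto simp: lessThan_empty_iff)
  then have "highest_bidders n v \<noteq> {}"
    by (auto simp: highest_bidders_def)
  then show ?thesis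
    by (simp add: card_gt_0_iff highest_bidders_def)
qed

text \<open>The winning probabilities add up to 1 whenever a sale takes place, so tie-breaking has
  no influence on the total payment.\<close>

lemma SPA_revenue:
  assumes "n \<ge> 1"
  shows "(\<Sum>i<n. payment (SPA a n r) v i) =
    (if r \<le> highest n v then max (second_highest a n v) r else 0)"
proof -
  have "(\<Sum>i<n. spa_alloc n r v i) = (if r \<le> highest n v then 1 else 0)"
  proof (cases "r \<le> highest n v")
    case True
    have "(\<Sum>i<n. spa_alloc n r v i) =
        (\<Sum>i\<in>highest_bidders n v. 1 / real (card (highest_bidders n v)))"
      using True by (intro sum.mono_neutral_cong_right)
        (auto simp: spa_alloc_def highest_bidders_def)
    then show ?thesis
      using True highest_bidders_nonempty[OF assms, of v] by simp
  qed (simp add: spa_alloc_def)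
  then show ?thesis
    by (simp add: SPA_def flip: sum_distrib_right)
qed

lemma second_highest_bounds:
  assumes "n \<ge> 1" and "\<And>i. i < n \<Longrightarrow> a \<le> v i"
  shows "a \<le> second_highest a n v" and "second_highest a n v \<le> highest n v"
proof -
  have "a \<le> second_highest a n v \<and> second_highest a n v \<le> highest n v"
  proof (cases "n = 1")
    case True
    then show ?thesis using assms by (simp add: second_highest_def highest_def lessThan_Suc)
  next
    case False
    then have n: "n \<ge> 2" using assms(1) by simp
    have "a \<le> second_highest a n v"
    proof (rule ccontr)
      assume "\<not> a \<le> second_highest a n v"
      then have "\<exists>i<n. \<exists>j<n. i \<noteq> j \<and> second_highest a n v < v i \<and> second_highest a n v < v j"
        using n assms(2)[of 0] assms(2)[of 1]
        by (intro exI[of _ 0] exI[of _ 1] conjI) auto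
      then show False using less_second_highest_iff[OF n, of "second_highest a n v" a v] by auto
    qed
    moreover have "second_highest a n v \<le> highest n v"
      using less_second_highest_iff[OF n, of "highest n v" a v] highest_le_iff[OF assms(1), of v "highest n v"]
      by (metis leD leI order_refl)
    ultimately show ?thesis ..
  qed
  then show "a \<le> second_highest a n v" "second_highest a n v \<le> highest n v" by auto
qed

lemma borel_measurable_highest [measurable]:
  "highest n \<in> borel_measurable (Pi\<^sub>M {..<n} (\<lambda>_. borel))"
  unfolding highest_def[abs_def] by measurable

lemma borel_measurable_second_highest [measurable]:
  assumes "n \<ge> 1"
  shows "second_highest a n \<in> borel_measurable (Pi\<^sub>M {..<n} (\<lambda>_. borel))"
proof (cases "n = 1")
  case True
  then show ?thesis by (simp add: second_highest_def[abs_def])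
next
  case False
  then have "n \<ge> 2" using assms by simp
  \<comment> \<open>Sorting is avoided: each superlevel set is a finite combination of conditions on
    single coordinates.\<close>
  then show ?thesis
    unfolding borel_measurable_iff_greater less_second_highest_iff[OF \<open>n \<ge> 2\<close>]
    by measurable
qed

section \<open>Distribution of the two highest of \<open>n\<close> iid valuations\<close>

context
  fixes F :: "real measure" and a b :: real
  assumes F: "F \<in> dists_on a b"
begin

lemma prob_space_dists_on: "prob_space F"
  using F by (simp add: dists_on_def)

lemma sets_dists_on [measurable_cong]: "sets F = sets borel"
  using F by (simp add: dists_on_def)

lemma space_dists_on: "space F = UNIV"
  using sets_eq_imp_space_eq[OF sets_dists_on] by simp

interpretation F: prob_space F by (rule prob_space_dists_on)

interpretation P: finite_product_prob_space "\<lambda>_. F" "{..<n}" for n :: nat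
  by unfold_locales auto

lemma sets_iid [measurable_cong]:
  "sets (Pi\<^sub>M {..<n} (\<lambda>_. F)) = sets (Pi\<^sub>M {..<n} (\<lambda>_. borel :: real measure))"
  by (intro sets_PiM_cong sets_dists_on refl)

lemma space_iid: "space (Pi\<^sub>M {..<n} (\<lambda>_. F)) = extensional {..<n :: nat}"
  by (simp add: space_PiM space_dists_on PiE_def)

lemma measure_le_Compl: "measure F {t<..} = 1 - measure F {..t}"
  using F.prob_compl[of "{..t}"]
  by (simp add: sets_dists_on space_dists_on Compl_eq_Diff_UNIV[symmetric])

lemma AE_dists_on: "AE x in F. a \<le> x \<and> x \<le> b"
proof -
  have "measure F {a..b} = 1"
    using F by (simp add: dists_on_def measure_def)
  then have "AE x in F. x \<in> {a..b}"
    by (subst F.AE_in_set_eq_1) (simp_all add: sets_dists_on)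
  then show ?thesis by simp
qed

lemma AE_iid: "AE v in Pi\<^sub>M {..<n} (\<lambda>_. F). \<forall>i<n::nat. a \<le> v i \<and> v i \<le> b"
proof -
  have "AE v in Pi\<^sub>M {..<n} (\<lambda>_. F). \<forall>i\<in>{..<n::nat}. a \<le> v i \<and> v i \<le> b"
    by (intro eventually_ball_finite ballI finite_lessThan
        AE_PiM_component[of _ "\<lambda>_. F" _ "\<lambda>x. a \<le> x \<and> x \<le> b"] AE_dists_on F.prob_space_axioms)
  then show ?thesis by (simp add: Ball_def)
qed

lemma prob_highest_le:
  assumes "n \<ge> 1"
  shows "measure (Pi\<^sub>M {..<n} (\<lambda>_. F)) {v \<in> space (Pi\<^sub>M {..<n} (\<lambda>_. F)). highest n v \<le> t} =
    measure F {..t} ^ n"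
proof -
  have "{v \<in> space (Pi\<^sub>M {..<n} (\<lambda>_. F)). highest n v \<le> t} = (\<Pi>\<^sub>E i\<in>{..<n}. {..t})"
    using assms by (auto simp: highest_le_iff space_iid PiE_def Pi_def)
  then show ?thesis
    by (simp add: P.prob_times sets_dists_on)
qed

text \<open>The strict version is the probability of no sale, which differs from the previous one if
  \<open>F\<close> has an atom at the reserve.\<close>

lemma prob_highest_less:
  assumes "n \<ge> 1"
  shows "measure (Pi\<^sub>M {..<n} (\<lambda>_. F)) {v \<in> space (Pi\<^sub>M {..<n} (\<lambda>_. F)). highest n v < t} =
    measure F {..<t} ^ n"
proof -
  have "{v \<in> space (Pi\<^sub>M {..<n} (\<lambda>_. F)). highest n v < t} = (\<Pi>\<^sub>E i\<in>{..<n}. {..<t})"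
    using assms by (auto simp: highest_less_iff space_iid PiE_def Pi_def)
  then show ?thesis
    by (simp add: P.prob_times sets_dists_on)
qed

text \<open>At most one entry exceeds \<open>t\<close>: either none does (\<open>B\<close>), or
  exactly the one of buyer \<open>i\<close> (\<open>C i\<close>). These disjoint events have
  probabilities \<open>F t ^ n\<close> and \<open>(1 - F t) * F t ^ (n - 1)\<close>.\<close>

lemma prob_second_highest_le:
  assumes "n \<ge> 1" and "a \<le> t"
  shows "measure (Pi\<^sub>M {..<n} (\<lambda>_. F)) {v \<in> space (Pi\<^sub>M {..<n} (\<lambda>_. F)). second_highest a n v \<le> t} =
    real n * measure F {..t} ^ (n - 1) - (real n - 1) * measure F {..t} ^ n"
proof (cases "n = 1")
  \<comment> \<open>For one buyer the second-highest entry is \<open>a \<le> t\<close> by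
    convention, and the formula reads 1.\<close>
  case True
  then show ?thesis
    using assms prob_space.prob_space[OF P.prob_space_axioms[of n]]
    by (simp add: second_highest_def)
next
  case False
  then have n: "n \<ge> 2" using assms(1) by simp
  define B where "B = (\<Pi>\<^sub>E i\<in>{..<n}. {..t})"
  define C where "C i = (\<Pi>\<^sub>E j\<in>{..<n}. if j = i then {t<..} else {..t})" for i
  have "second_highest a n v \<le> t \<longleftrightarrow> (\<forall>i<n. v i \<le> t) \<or> (\<exists>i<n. t < v i \<and> (\<forall>j<n. j \<noteq> i \<longrightarrow> v j \<le> t))" for v
    unfolding not_less[symmetric] less_second_highest_iff[OF n] by blast
  then have set_eq: "{v \<in> space (Pi\<^sub>M {..<n} (\<lambda>_. F)). second_highest a n v \<le> t} = B \<union> (\<Union>i<n. C i)"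
    by (auto simp: B_def C_def space_iid PiE_def Pi_def split: if_splits)
  have sets_B [measurable]: "B \<in> sets (Pi\<^sub>M {..<n} (\<lambda>_. F))"
    unfolding B_def by (intro sets_PiM_I_finite) (auto simp: sets_dists_on)
  have sets_C [measurable]: "C i \<in> sets (Pi\<^sub>M {..<n} (\<lambda>_. F))" for i
    unfolding C_def by (intro sets_PiM_I_finite) (auto simp: sets_dists_on)
  have disj: "B \<inter> (\<Union>i<n. C i) = {}"
  proof (safe, goal_cases)
    case (1 f i)
    then have "f i \<in> {..t}" "f i \<in> (if i = i then {t<..} else {..t})"
      unfolding B_def C_def by (blast intro: PiE_mem)+
    then show ?case by simp
  qed
  have disj': "disjoint_family_on C {..<n}"
    unfolding disjoint_family_on_def
  proof (safe, goal_cases)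
    case (1 i j f)
    then have "f i \<in> (if i = i then {t<..} else {..t})" "f i \<in> (if i = j then {t<..} else {..t})"
      unfolding C_def by (blast intro: PiE_mem)+
    then show ?case using 1 by simp
  qed
  have "measure (Pi\<^sub>M {..<n} (\<lambda>_. F)) (C i) = (1 - measure F {..t}) * measure F {..t} ^ (n - 1)"
    if "i < n" for i
  proof -
    have "measure (Pi\<^sub>M {..<n} (\<lambda>_. F)) (C i) =
        (\<Prod>j<n. measure F (if j = i then {t<..} else {..t}))"
      unfolding C_def by (intro P.prob_times) (auto simp: sets_dists_on)
    also have "\<dots> = (\<Prod>j<n. if j = i then measure F {t<..} else measure F {..t})"
      by (intro prod.cong) auto
    also have "\<dots> = measure F {t<..} * (\<Prod>j\<in>{..<n} - {i}. measure F {..t})"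
      using that by (subst prod.remove[of _ i]) (auto intro!: prod.cong)
    finally show ?thesis
      using that by (simp add: measure_le_Compl)
  qed
  then have "measure (Pi\<^sub>M {..<n} (\<lambda>_. F)) (\<Union>i<n. C i) =
      real n * ((1 - measure F {..t}) * measure F {..t} ^ (n - 1))"
    using disj' by (subst P.finite_measure_finite_Union) auto
  moreover have "measure (Pi\<^sub>M {..<n} (\<lambda>_. F)) B = measure F {..t} ^ n"
    unfolding B_def by (simp add: P.prob_times sets_dists_on)
  moreover have "measure F {..t} ^ n = measure F {..t} * measure F {..t} ^ (n - 1)"
    using assms(1) by (simp add: power_eq_if)
  ultimately show ?thesis
    unfolding set_eq using disj
    by (subst P.finite_measure_Union) (auto simp: algebra_simps)
qed

end

section \<open>Regret as an integral over thresholds\<close>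

lemma restrict_interval_step:
  fixes a b c d :: real
  assumes "a \<le> c" "c \<le> d" "d \<le> b"
  shows measure_restrict_interval: "measure (restrict_space lborel {a..<b}) {c..<d} = d - c"
    and integrable_restrict_interval:
      "integrable (restrict_space lborel {a..<b}) (indicator {c..<d} :: real \<Rightarrow> real)"
    and integral_restrict_interval:
      "(\<integral>t. indicator {c..<d} t \<partial>restrict_space lborel {a..<b}) = d - c"
proof -
  have *: "emeasure (restrict_space lborel {a..<b}) {c..<d} = ennreal (d - c)"
    using assms by (subst emeasure_restrict_space) auto
  have sets: "{c..<d} \<in> sets (restrict_space lborel {a..<b})"
    using assms by (auto simp: sets_restrict_space_iff)
  show "measure (restrict_space lborel {a..<b}) {c..<d} = d - c"
    using assms * by (simp add: measure_def)
  then show "(\<integral>t. indicator {c..<d} t \<partial>restrict_space lborel {a..<b}) = d - c"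
    using assms by (simp add: space_restrict_space Int_absorb2)
  show "integrable (restrict_space lborel {a..<b}) (indicator {c..<d} :: real \<Rightarrow> real)"
    using sets * by (intro integrable_real_indicator) auto
qed

lemma finite_measure_restrict_interval:
  "finite_measure (restrict_space lborel {a..<b :: real})"
  by (intro finite_measureI, cases "a \<le> b") (simp_all add: emeasure_restrict_space space_restrict_space)

text \<open>The highest entry is \<open>a\<close> plus the length of \<open>[a, v1)\<close>; the
  price in a sale is \<open>r\<close> plus the length of \<open>[r, v2)\<close>. Without a sale
  \<open>v2 \<le> v1 < r\<close>, so the second interval is empty.\<close>

lemma SPA_layer_cake:
  assumes "n \<ge> 1" and "a \<le> r" and v: "\<And>i. i < n \<Longrightarrow> a \<le> v i \<and> v i \<le> b" and "r \<le> b"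
  shows "lam * highest n v - (\<Sum>i<n. payment (SPA a n r) v i) =
    lam * a - r * (if highest n v < r then 0 else 1) +
    (\<integral>t. lam * (if t < highest n v then 1 else 0)
        - (if r \<le> t \<and> t < second_highest a n v then 1 else 0) \<partial>restrict_space lborel {a..<b})"
proof -
  let ?L = "restrict_space lborel {a..<b}"
  let ?v1 = "highest n v" and ?v2 = "second_highest a n v"
  have v1: "?v1 \<le> b" and v2: "a \<le> ?v2" "?v2 \<le> ?v1"
    using highest_le_iff[OF assms(1), of v b] second_highest_bounds[OF assms(1), of a v] v by auto
  \<comment> \<open>The \<open>max\<close> keeps the endpoints ordered when \<open>v2 < r\<close>,
    where the interval is empty.\<close>
  have "(\<integral>t. lam * (if t < ?v1 then 1 else 0) - (if r \<le> t \<and> t < ?v2 then 1 else 0) \<partial>?L) =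
      (\<integral>t. lam * indicator {a..<?v1} t - indicator {r..<max ?v2 r} t \<partial>?L)"
    by (intro Bochner_Integration.integral_cong)
      (auto simp: space_restrict_space indicator_def)
  also have "\<dots> = lam * (?v1 - a) - (max ?v2 r - r)"
    using assms v1 v2
    by (subst Bochner_Integration.integral_diff)
      (simp_all add: integrable_restrict_interval integral_restrict_interval
        del: Bochner_Integration.integral_indicator)
  finally show ?thesis
    using v2 SPA_revenue[OF assms(1), of a r v] by (auto simp: algebra_simps)
qed

text \<open>Fubini applied to the layer-cake form turns the indicators of \<open>t < v1\<close> and
  \<open>t < v2\<close> into tail probabilities, which depend on \<open>F t\<close> alone.
  Integrability is recorded for the later pointwise comparison of integrands.\<close>

lemma regret_SPA:
  assumes F: "F \<in> dists_on a b" and n: "n \<ge> 1" and r: "a \<le> r" "r \<le> b"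
  shows "regret n lam (SPA a n r) (Pi\<^sub>M {..<n} (\<lambda>_. F)) =
    lam * a - r * (1 - measure F {..<r} ^ n) +
    (\<integral>t. lam * (1 - measure F {..t} ^ n) -
        (if r \<le> t then 1 - real n * measure F {..t} ^ (n - 1) + (real n - 1) * measure F {..t} ^ n
         else 0) \<partial>restrict_space lborel {a..<b})"
    and "integrable (restrict_space lborel {a..<b}) (\<lambda>t. lam * (1 - measure F {..t} ^ n) -
        (if r \<le> t then 1 - real n * measure F {..t} ^ (n - 1) + (real n - 1) * measure F {..t} ^ n
         else 0))"
proof -
  let ?L = "restrict_space lborel {a..<b}" and ?P = "Pi\<^sub>M {..<n} (\<lambda>_. F)"
  interpret P: prob_space ?P
    by (intro prob_space_PiM prob_space_dists_on[OF F])
  interpret L: finite_measure ?L by (rule finite_measure_restrict_interval)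
  interpret LP: finite_measure "?L \<Otimes>\<^sub>M ?P"
    by (intro finite_measure_pair_measure P.finite_measure_axioms L.finite_measure_axioms)
  interpret pair_sigma_finite ?L ?P ..
  have [measurable]: "highest n \<in> borel_measurable ?P" "second_highest a n \<in> borel_measurable ?P"
    using borel_measurable_highest[of n] borel_measurable_second_highest[OF n, of a]
    by (simp_all add: measurable_cong_sets[OF sets_iid[OF F] refl])
  define K :: "real \<Rightarrow> (nat \<Rightarrow> real) \<Rightarrow> real" where
    "K t v = lam * (if t < highest n v then 1 else 0)
        - (if r \<le> t \<and> t < second_highest a n v then 1 else 0)" for t v
  have [measurable]: "(\<lambda>t. t) \<in> borel_measurable ?L"
    by (intro measurable_restrict_space1) simp
  have K_meas [measurable]: "case_prod K \<in> borel_measurable (?L \<Otimes>\<^sub>M ?P)"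
    unfolding K_def by measurable
  have K_bound: "\<bar>K t v\<bar> \<le> \<bar>lam\<bar> + 1" for t v
    using abs_triangle_ineq4[of lam 1] by (simp add: K_def)
  \<comment> \<open>A bounded kernel on a finite product measure: this justifies Fubini and also
    yields the second conclusion.\<close>
  have int_K: "integrable (?L \<Otimes>\<^sub>M ?P) (case_prod K)"
    by (rule LP.integrable_const_bound[of _ "\<bar>lam\<bar> + 1"]) (auto simp: K_bound)
  have ind_P: "integrable ?P (\<lambda>v. if Q v then 1 else 0 :: real)"
    "(\<integral>v. (if Q v then 1 else 0) \<partial>?P) = 1 - P.prob {v \<in> space ?P. \<not> Q v}"
    if [measurable]: "Measurable.pred ?P Q" for Q
  proof -
    show "integrable ?P (\<lambda>v. if Q v then 1 else 0 :: real)"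
      by (rule P.integrable_const_bound[of _ 1]) auto
    have "(\<integral>v. (if Q v then 1 else 0 :: real) \<partial>?P) = (\<integral>v. indicator {v \<in> space ?P. Q v} v \<partial>?P)"
      by (intro Bochner_Integration.integral_cong) auto
    then show "(\<integral>v. (if Q v then 1 else 0) \<partial>?P) = 1 - P.prob {v \<in> space ?P. \<not> Q v}"
      by (simp add: P.prob_neg)
  qed
  have inner: "(\<integral>v. K t v \<partial>?P) = lam * (1 - measure F {..t} ^ n) -
        (if r \<le> t then 1 - real n * measure F {..t} ^ (n - 1) + (real n - 1) * measure F {..t} ^ n
         else 0)" if "a \<le> t" for t
  proof -
    have "(\<integral>v. (if t < highest n v then 1 else 0) \<partial>?P) = 1 - measure F {..t} ^ n"
      by (subst ind_P(2)) (simp_all add: not_less prob_highest_le[OF F n])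
    moreover have "(\<integral>v. (if t < second_highest a n v then 1 else 0) \<partial>?P) =
        1 - real n * measure F {..t} ^ (n - 1) + (real n - 1) * measure F {..t} ^ n"
      by (subst ind_P(2)) (simp_all add: not_less prob_second_highest_le[OF F n that])
    ultimately show ?thesis
      unfolding K_def
      by (cases "r \<le> t") (simp_all add: ind_P(1))
  qed
  have "regret n lam (SPA a n r) ?P =
      (\<integral>v. lam * a - r * (1 - (if highest n v < r then 1 else 0)) + (\<integral>t. K t v \<partial>?L) \<partial>?P)"
    unfolding regret_def
  proof (rule integral_cong_AE)
    show "AE v in ?P. lam * highest n v - (\<Sum>i<n. payment (SPA a n r) v i) =
        lam * a - r * (1 - (if highest n v < r then 1 else 0)) + (\<integral>t. K t v \<partial>?L)"
      using AE_iid[OF F, of n]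
    proof eventually_elim
      case (elim v)
      show ?case
        unfolding K_def using SPA_layer_cake[OF n r(1) _ r(2), of v lam] elim by auto
    qed
  \<comment> \<open>Measurability is read off the closed form of the revenue, not off the
    tie-breaking weights.\<close>
  qed (unfold SPA_revenue[OF n], measurable)
  also have "\<dots> = lam * a - r * measure ?P {v \<in> space ?P. \<not> highest n v < r} + (\<integral>v. (\<integral>t. K t v \<partial>?L) \<partial>?P)"
    using integrable_snd[OF int_K] by (simp add: ind_P P.prob_space)
  also have "(\<integral>v. (\<integral>t. K t v \<partial>?L) \<partial>?P) = (\<integral>t. (\<integral>v. K t v \<partial>?P) \<partial>?L)"
    by (rule Fubini_integral[OF int_K])
  also have "\<dots> = (\<integral>t. lam * (1 - measure F {..t} ^ n) -
        (if r \<le> t then 1 - real n * measure F {..t} ^ (n - 1) + (real n - 1) * measure F {..t} ^ n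
         else 0) \<partial>?L)"
    by (intro Bochner_Integration.integral_cong inner) (simp_all add: space_restrict_space)
  also have "measure ?P {v \<in> space ?P. \<not> highest n v < r} = 1 - measure F {..<r} ^ n"
    by (subst P.prob_neg) (simp_all add: prob_highest_less[OF F n])
  finally show "regret n lam (SPA a n r) ?P =
    lam * a - r * (1 - measure F {..<r} ^ n) +
    (\<integral>t. lam * (1 - measure F {..t} ^ n) -
        (if r \<le> t then 1 - real n * measure F {..t} ^ (n - 1) + (real n - 1) * measure F {..t} ^ n
         else 0) \<partial>?L)" .
  show "integrable ?L (\<lambda>t. lam * (1 - measure F {..t} ^ n) -
        (if r \<le> t then 1 - real n * measure F {..t} ^ (n - 1) + (real n - 1) * measure F {..t} ^ n
         else 0))"
    (is "integrable ?L ?g")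
  proof -
    have "integrable ?L (\<lambda>t. \<integral>v. K t v \<partial>?P) \<longleftrightarrow> integrable ?L ?g"
      by (intro Bochner_Integration.integrable_cong inner) (simp_all add: space_restrict_space)
    then show ?thesis using integrable_fst[OF int_K] by simp
  qed
qed

section \<open>Upper and lower bounds on the regret\<close>

text \<open>The integrand is bounded by \<open>lam\<close> below \<open>r\<close> and by a constant
  above it. The assumption on \<open>M\<close> ranges only over \<open>z\<close> at least
  \<open>F(r-)\<close>, because \<open>F t\<close> has this property for
  \<open>t \<ge> r\<close>.\<close>

lemma regret_SPA_le:
  assumes F: "F \<in> dists_on a b" and n: "n \<ge> 1" and r: "a \<le> r" "r \<le> b" and lam: "0 \<le> lam"
    and M: "\<And>z. measure F {..<r} \<le> z \<Longrightarrow> z \<le> 1 \<Longrightarrow>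
      r * measure F {..<r} ^ n + (b - r) * (real n * z ^ (n - 1) - (real n - 1 + lam) * z ^ n) \<le> M"
  shows "regret n lam (SPA a n r) (Pi\<^sub>M {..<n} (\<lambda>_. F)) \<le> - (1 - lam) * b + M"
proof -
  let ?L = "restrict_space lborel {a..<b}"
  interpret F: prob_space F by (rule prob_space_dists_on[OF F])
  define q where "q = measure F {..<r}"
  \<comment> \<open>The integrand above \<open>r\<close> is \<open>lam - 1\<close> plus the
    polynomial in \<open>M\<close>; solving that assumption for the polynomial gives
    \<open>C\<close>.\<close>
  define C where "C = lam - 1 + (M - r * q ^ n) / (b - r)"
  have q: "0 \<le> q" "q \<le> 1" by (simp_all add: q_def)
  have C: "(b - r) * C \<le> (b - r) * (lam - 1) + M - r * q ^ n"
  proof (cases "r = b")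
    \<comment> \<open>Here the quotient in \<open>C\<close> is 0 by default; the assumption at
      \<open>z = 1\<close> still gives \<open>r * q ^ n \<le> M\<close>.\<close>
    case True
    then show ?thesis using M[of 1] q by (simp add: q_def)
  next
    case False
    then show ?thesis using r by (simp add: C_def field_simps)
  qed
  have "(\<integral>t. lam * (1 - measure F {..t} ^ n) -
        (if r \<le> t then 1 - real n * measure F {..t} ^ (n - 1) + (real n - 1) * measure F {..t} ^ n
         else 0) \<partial>?L) \<le> (\<integral>t. lam * indicator {a..<r} t + C * indicator {r..<b} t \<partial>?L)"
  proof (rule integral_mono[OF regret_SPA(2)[OF F n r]])
    show "integrable ?L (\<lambda>t. lam * indicator {a..<r} t + C * indicator {r..<b} t)"
      using r by (intro Bochner_Integration.integrable_add integrable_mult_right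
        integrable_restrict_interval) auto
    fix t assume "t \<in> space ?L"
    then have t: "a \<le> t" "t < b" by (auto simp: space_restrict_space)
    show "lam * (1 - measure F {..t} ^ n) -
        (if r \<le> t then 1 - real n * measure F {..t} ^ (n - 1) + (real n - 1) * measure F {..t} ^ n
         else 0) \<le> lam * indicator {a..<r} t + C * indicator {r..<b} t"
    proof (cases "r \<le> t")
      case True
      then have "q \<le> measure F {..t}"
        unfolding q_def by (intro F.finite_measure_mono) (auto simp: sets_dists_on[OF F])
      then have "(b - r) * (real n * measure F {..t} ^ (n - 1) - (real n - 1 + lam) * measure F {..t} ^ n)
          \<le> M - r * q ^ n"
        using M[of "measure F {..t}"] by (simp add: q_def)
      moreover have "0 < b - r" using True t by simp
      ultimately have "real n * measure F {..t} ^ (n - 1) - (real n - 1 + lam) * measure F {..t} ^ n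
          \<le> (M - r * q ^ n) / (b - r)"
        by (simp add: field_simps)
      then show ?thesis
        using True t by (simp add: C_def algebra_simps)
    next
      case False
      have "lam * (1 - measure F {..t} ^ n) \<le> lam * 1"
        using lam by (intro mult_left_mono) auto
      then show ?thesis using False t by simp
    qed
  qed
  also have "\<dots> = lam * (r - a) + C * (b - r)"
    using r by (subst Bochner_Integration.integral_add)
      (simp_all add: integrable_restrict_interval integral_restrict_interval
        del: Bochner_Integration.integral_indicator)
  finally show ?thesis
    using C unfolding regret_SPA(1)[OF F n r] q_def[symmetric] by (simp add: algebra_simps)
qed

definition two_point :: "real \<Rightarrow> real \<Rightarrow> real \<Rightarrow> real measure" where
  "two_point q s b = distr (measure_pmf (bernoulli_pmf q)) borel (\<lambda>x. if x then s else b)"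

lemma measure_two_point:
  assumes "0 \<le> q" "q \<le> 1" and A: "A \<in> sets borel"
  shows "measure (two_point q s b) A =
    (if s \<in> A then q else 0) + (if b \<in> A then 1 - q else 0)"
proof -
  have "measure (two_point q s b) A = (\<Sum>x\<in>{x. (if x then s else b) \<in> A}. pmf (bernoulli_pmf q) x)"
    unfolding two_point_def using A
    by (subst measure_distr) (auto simp: measure_measure_pmf_finite vimage_def)
  also have "\<dots> = (\<Sum>x\<in>UNIV. if (if x then s else b) \<in> A then pmf (bernoulli_pmf q) x else 0)"
    by (intro sum.mono_neutral_cong_left) auto
  also have "\<dots> = (if s \<in> A then q else 0) + (if b \<in> A then 1 - q else 0)"
    using assms by (simp add: UNIV_bool)
  finally show ?thesis .
qed

lemma two_point_in_dists_on:
  assumes "0 \<le> q" "q \<le> 1" "a \<le> s" "s \<le> b"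
  shows "two_point q s b \<in> dists_on a b"
proof -
  interpret prob_space "two_point q s b"
    unfolding two_point_def by (intro prob_space.prob_space_distr prob_space_measure_pmf) simp
  show ?thesis
    unfolding dists_on_def using assms prob_space_axioms
    by (simp add: emeasure_eq_measure measure_two_point two_point_def[THEN arg_cong[where f = sets]])
qed

text \<open>The distribution function is \<open>q\<close> on \<open>[s, b)\<close>, so the integrand
  is constant on \<open>[a, s)\<close>, \<open>[s, r)\<close> and \<open>[r, b)\<close>. An atom at
  \<open>s\<close> can prevent a sale only if \<open>s < r\<close>, whence the case
  distinction.\<close>

lemma regret_SPA_two_point:
  assumes q: "0 \<le> q" "q \<le> 1" and n: "n \<ge> 1" and s: "a \<le> s" "s \<le> r" "s < b" "r \<le> b"
  shows "regret n lam (SPA a n r) (Pi\<^sub>M {..<n} (\<lambda>_. two_point q s b)) =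
    - (1 - lam) * b + (b - r) * (real n * q ^ (n - 1) - (real n - 1 + lam) * q ^ n)
    + (if s < r then (r - lam * (r - s)) * q ^ n else 0)"
proof -
  let ?L = "restrict_space lborel {a..<b}"
  have F: "two_point q s b \<in> dists_on a b"
    using assms by (intro two_point_in_dists_on) auto
  have r: "a \<le> r" using s by simp
  define C where "C = lam * (1 - q ^ n) - (1 - real n * q ^ (n - 1) + (real n - 1) * q ^ n)"
  have cdf: "measure (two_point q s b) {..t} = (if t < s then 0 else q)" if "t < b" for t
    using that q by (subst measure_two_point) auto
  have cdf': "measure (two_point q s b) {..<r} = (if s < r then q else 0)"
    using s q by (subst measure_two_point) auto
  have "(\<integral>t. lam * (1 - measure (two_point q s b) {..t} ^ n) -
        (if r \<le> t then 1 - real n * measure (two_point q s b) {..t} ^ (n - 1)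
           + (real n - 1) * measure (two_point q s b) {..t} ^ n else 0) \<partial>?L) =
      (\<integral>t. lam * indicator {a..<s} t + (lam * (1 - q ^ n) * indicator {s..<r} t + C * indicator {r..<b} t) \<partial>?L)"
    using s n by (intro Bochner_Integration.integral_cong)
      (auto simp: space_restrict_space cdf C_def indicator_def power_0_left)
  also have "\<dots> = lam * (s - a) + (lam * (1 - q ^ n) * (r - s) + C * (b - r))"
    using s by (subst Bochner_Integration.integral_add, (simp_all add: integrable_restrict_interval)[2],
        subst Bochner_Integration.integral_add)
      (simp_all add: integrable_restrict_interval integral_restrict_interval
        del: Bochner_Integration.integral_indicator)
  finally show ?thesis
    unfolding regret_SPA(1)[OF F n r s(4)] cdf' C_def using s n
    by (auto simp: algebra_simps power_0_left)
qed

lemma regret_le_worst_regret: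
  assumes "F \<in> dists_on a b"
  shows "ereal (regret n lam m (Pi\<^sub>M {..<n} (\<lambda>_. F))) \<le> worst_regret n a b lam m"
  unfolding worst_regret_def iid_class_def using assms by (intro SUP_upper imageI)

text \<open>The limit of the two-point regret as \<open>s\<close> increases to \<open>r\<close>,
  with the constant \<open>- (1 - lam) * b\<close> removed.\<close>

definition SPA_loss :: "nat \<Rightarrow> real \<Rightarrow> real \<Rightarrow> real \<Rightarrow> real \<Rightarrow> real" where
  "SPA_loss n lam b r z =
     (b - r) * (real n * z ^ (n - 1) - (real n - 1 + lam) * z ^ n) + r * z ^ n"

text \<open>The two-point regret falls short of this value by \<open>lam * (r - s) * z ^ n\<close>,
  which vanishes as \<open>s\<close> tends to \<open>r\<close> from the left. Taking
  \<open>s = r\<close> would not do, since a bid equal to the reserve wins.\<close>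

lemma SPA_loss_le_worst_regret:
  assumes z: "0 \<le> z" "z \<le> 1" and n: "n \<ge> 1" and r: "a < r" "r \<le> b"
  shows "ereal (- (1 - lam) * b + SPA_loss n lam b r z) \<le> worst_regret n a b lam (SPA a n r)"
proof (rule tendsto_upperbound)
  show "((\<lambda>s. ereal (- (1 - lam) * b + (SPA_loss n lam b r z - lam * (r - s) * z ^ n))) \<longlongrightarrow>
      ereal (- (1 - lam) * b + SPA_loss n lam b r z)) (at_left r)"
    by (auto intro!: tendsto_eq_intros)
  have "\<forall>\<^sub>F s in at_left r. a < s \<and> s < r"
    using r eventually_at_left[of a r] by (metis (no_types, lifting))
  then show "\<forall>\<^sub>F s in at_left r. ereal (- (1 - lam) * b + (SPA_loss n lam b r z - lam * (r - s) * z ^ n))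
      \<le> worst_regret n a b lam (SPA a n r)"
  proof eventually_elim
    case (elim s)
    have "- (1 - lam) * b + (SPA_loss n lam b r z - lam * (r - s) * z ^ n) =
        regret n lam (SPA a n r) (Pi\<^sub>M {..<n} (\<lambda>_. two_point z s b))"
      using elim r by (subst regret_SPA_two_point[OF z n]) (auto simp: SPA_loss_def algebra_simps)
    also have "ereal \<dots> \<le> worst_regret n a b lam (SPA a n r)"
      using elim r z by (intro regret_le_worst_regret two_point_in_dists_on) auto
    finally show ?case by simp
  qed
qed simp

section \<open>Reduction to maximising a polynomial\<close>

text \<open>The upper bound involves both \<open>F(r-)\<close> and \<open>z \<ge> F(r-)\<close>. As
  \<open>r \<ge> 0\<close>, replacing the former by \<open>z\<close> only increases it and leaves
  \<open>SPA_loss\<close>.\<close>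

lemma worst_regret_SPA_positive_reserve:
  assumes "0 \<le> lam" "0 \<le> a" and n: "n \<ge> 1" and r: "a < r" "r \<le> b" and z0: "0 \<le> z0" "z0 \<le> 1"
    and max: "\<And>z. 0 \<le> z \<Longrightarrow> z \<le> 1 \<Longrightarrow> SPA_loss n lam b r z \<le> SPA_loss n lam b r z0"
  shows "worst_regret n a b lam (SPA a n r) = ereal (- (1 - lam) * b + SPA_loss n lam b r z0)"
proof (rule antisym)
  show "worst_regret n a b lam (SPA a n r) \<le> ereal (- (1 - lam) * b + SPA_loss n lam b r z0)"
    unfolding worst_regret_def iid_class_def
  proof (safe intro!: SUP_least)
    fix F assume F: "F \<in> dists_on a b"
    show "ereal (regret n lam (SPA a n r) (Pi\<^sub>M {..<n} (\<lambda>_. F)))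
        \<le> ereal (- (1 - lam) * b + SPA_loss n lam b r z0)"
      unfolding ereal_less_eq
    proof (rule regret_SPA_le[OF F n])
      fix z assume z: "measure F {..<r} \<le> z" "z \<le> 1"
      then have "r * measure F {..<r} ^ n \<le> r * z ^ n"
        using r assms(2) by (intro mult_left_mono power_mono) auto
      moreover have "0 \<le> z" using z(1) measure_nonneg order_trans by blast
      ultimately show "r * measure F {..<r} ^ n +
          (b - r) * (real n * z ^ (n - 1) - (real n - 1 + lam) * z ^ n) \<le> SPA_loss n lam b r z0"
        using max[of z] z by (simp add: SPA_loss_def)
    qed (use assms in auto)
  qed
  show "ereal (- (1 - lam) * b + SPA_loss n lam b r z0) \<le> worst_regret n a b lam (SPA a n r)"
    by (rule SPA_loss_le_worst_regret[OF z0 n r])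
qed

text \<open>No mass lies below \<open>a\<close>, so the term from unsold items vanishes, and an atom
  of mass \<open>z0\<close> at \<open>a\<close> attains the bound without a limit.\<close>

lemma worst_regret_SPA_no_reserve:
  assumes "0 \<le> lam" and n: "n \<ge> 1" and "a < b" and z0: "0 \<le> z0" "z0 \<le> 1"
    and max: "\<And>z. 0 \<le> z \<Longrightarrow> z \<le> 1 \<Longrightarrow>
      real n * z ^ (n - 1) - (real n - 1 + lam) * z ^ n \<le> real n * z0 ^ (n - 1) - (real n - 1 + lam) * z0 ^ n"
  shows "worst_regret n a b lam (SPA a n a) =
    ereal (- (1 - lam) * b + (b - a) * (real n * z0 ^ (n - 1) - (real n - 1 + lam) * z0 ^ n))"
    (is "_ = ereal (_ + ?M)")
proof (rule antisym)
  show "worst_regret n a b lam (SPA a n a) \<le> ereal (- (1 - lam) * b + ?M)"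
    unfolding worst_regret_def iid_class_def
  proof (safe intro!: SUP_least)
    fix F assume F: "F \<in> dists_on a b"
    interpret F: prob_space F by (rule prob_space_dists_on[OF F])
    have "AE x in F. x \<notin> {..<a}"
      using AE_dists_on[OF F] by eventually_elim auto
    then have 0: "measure F {..<a} = 0"
      by (subst F.prob_eq_0) (auto simp: sets_dists_on[OF F])
    show "ereal (regret n lam (SPA a n a) (Pi\<^sub>M {..<n} (\<lambda>_. F))) \<le> ereal (- (1 - lam) * b + ?M)"
      unfolding ereal_less_eq
    proof (rule regret_SPA_le[OF F n])
      fix z assume "measure F {..<a} \<le> z" "z \<le> 1"
      then show "a * measure F {..<a} ^ n +
          (b - a) * (real n * z ^ (n - 1) - (real n - 1 + lam) * z ^ n) \<le> ?M"
        using max[of z] \<open>a < b\<close> n by (simp add: 0 power_0_left mult_left_mono)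
    qed (use assms in auto)
  qed
  have "- (1 - lam) * b + ?M = regret n lam (SPA a n a) (Pi\<^sub>M {..<n} (\<lambda>_. two_point z0 a b))"
    using \<open>a < b\<close> by (subst regret_SPA_two_point[OF z0 n]) auto
  also have "ereal \<dots> \<le> worst_regret n a b lam (SPA a n a)"
    using \<open>a < b\<close> z0 by (intro regret_le_worst_regret two_point_in_dists_on) auto
  finally show "ereal (- (1 - lam) * b + ?M) \<le> worst_regret n a b lam (SPA a n a)" .
qed

text \<open>The equation for \<open>q\<close> says that the derivative vanishes there; AM-GM with
  \<open>y = q\<close>, multiplied by \<open>D\<close>, gives \<open>m\<close> times the claim. The
  product form also admits \<open>D = 0\<close>.\<close>

lemma interior_maximum:
  fixes c D q z :: real
  assumes "0 \<le> D" "D * q = real m * c" "0 \<le> q" "0 \<le> z"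
  shows "real (Suc m) * c * z ^ m - D * z ^ Suc m \<le> c * q ^ m"
proof (cases "m = 0")
  case True
  then show ?thesis using assms by simp
next
  case False
  have "D * (real (Suc m) * z ^ m * q) \<le> D * (real m * z ^ Suc m + q ^ Suc m)"
    using assms by (intro mult_left_mono weighted_AM_GM) auto
  then have "real (Suc m) * z ^ m * (D * q) - real m * (D * z ^ Suc m) \<le> (D * q) * q ^ m"
    by (simp add: algebra_simps)
  then have "real m * (real (Suc m) * c * z ^ m - D * z ^ Suc m) \<le> real m * (c * q ^ m)"
    unfolding assms(2) by (simp add: algebra_simps)
  then show ?thesis using False by simp
qed

text \<open>The maximum sits at \<open>z = 1\<close>: AM-GM with \<open>y = 1\<close> settles
  \<open>D = m * c\<close>, and a smaller \<open>D\<close> adds a multiple of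
  \<open>1 - z ^ Suc m\<close>.\<close>

lemma boundary_maximum:
  fixes c D z :: real
  assumes "D \<le> real m * c" "0 \<le> c" "0 \<le> z" "z \<le> 1"
  shows "real (Suc m) * c * z ^ m - D * z ^ Suc m \<le> real (Suc m) * c - D"
proof -
  have "c * (real (Suc m) * z ^ m * 1) \<le> c * (real m * z ^ Suc m + 1 ^ Suc m)"
    using assms by (intro mult_left_mono weighted_AM_GM) auto
  moreover have "D * (1 - z ^ Suc m) \<le> real m * c * (1 - z ^ Suc m)"
    using assms power_le_one[of z "Suc m"] by (intro mult_right_mono) auto
  ultimately show ?thesis by (simp add: algebra_simps)
qed

lemma SPA_loss_Suc:
  "SPA_loss (Suc m) lam b r z =
    real (Suc m) * (b - r) * z ^ m - ((real m + lam) * (b - r) - r) * z ^ Suc m"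
  by (simp add: SPA_loss_def algebra_simps)

section \<open>Closed forms in the three ranges of the reserve\<close>

lemma worst_regret_SPA_a:
  assumes "n \<ge> 1" and "0 < lam" and "a < b"
  shows "worst_regret n a b lam (SPA a n a) =
    ereal (- (1 - lam) * b + (b - a) * ((real n - 1) / (real n - 1 + lam)) ^ (n - 1))"
proof -
  obtain m where n: "n = Suc m" using assms(1) by (cases n) auto
  \<comment> \<open>The stationary point for \<open>c = 1\<close> and \<open>D = m + lam\<close>.
    For one buyer it is 0, and \<open>0 ^ 0 = 1\<close> agrees with the stated convention.\<close>
  define q where "q = real m / (real m + lam)"
  have q: "0 \<le> q" "q \<le> 1" and D: "(real m + lam) * q = real m * 1"
    using assms by (auto simp: q_def)
  have val: "real (Suc m) * q ^ m - (real m + lam) * q ^ Suc m = q ^ m"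
  proof -
    have "(real m + lam) * q ^ Suc m = ((real m + lam) * q) * q ^ m" by simp
    also have "\<dots> = real m * q ^ m" unfolding D by simp
    finally show ?thesis by (simp add: algebra_simps)
  qed
  have "real n * z ^ (n - 1) - (real n - 1 + lam) * z ^ n
      \<le> real n * q ^ (n - 1) - (real n - 1 + lam) * q ^ n" if "0 \<le> z" for z
    using interior_maximum[OF _ D q(1) that] assms val by (simp add: n add.commute)
  from worst_regret_SPA_no_reserve[OF _ assms(1,3) q this] assms(2) show ?thesis
    using val by (simp add: n q_def add.commute)
qed

text \<open>The range of \<open>r\<close> amounts to \<open>r \<le> lam * (b - r)\<close>, that is
  \<open>m * (b - r) \<le> D\<close>, which places the stationary point in
  \<open>[0, 1]\<close>.\<close>

lemma worst_regret_SPA_low_reserve: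
  assumes "n \<ge> 1" and "0 < lam" and "0 \<le> a" and r: "a < r" "r \<le> lam / (1 + lam) * b"
  shows "worst_regret n a b lam (SPA a n r) =
    ereal (- (1 - lam) * b
      + (b - r) ^ n * (real n - 1) ^ (n - 1) / ((real n - 1 + lam) * (b - r) - r) ^ (n - 1))"
proof -
  obtain m where n: "n = Suc m" using assms(1) by (cases n) auto
  have r_le: "r \<le> lam * (b - r)"
    using r(2) assms(2) by (simp add: field_simps)
  then have br: "0 < b - r" using r assms by (smt (verit) zero_less_mult_pos)
  define D where "D = (real m + lam) * (b - r) - r"
  define q where "q = real m * (b - r) / D"
  have D_ge: "real m * (b - r) \<le> D"
    using r_le by (simp add: D_def algebra_simps)
  then have D: "0 \<le> D" using br by (meson mult_nonneg_nonneg of_nat_0_le_iff less_imp_le order_trans)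
  \<comment> \<open>If \<open>D = 0\<close>, then \<open>D_ge\<close> forces \<open>m = 0\<close>,
    and both sides vanish.\<close>
  have Dq: "D * q = real m * (b - r)"
    using D_ge D br by (cases "D = 0") (auto simp: q_def zero_less_mult_iff mult_le_0_iff)
  have q: "0 \<le> q" "q \<le> 1"
    using D D_ge br by (auto simp: q_def divide_le_eq_1)
  have val: "SPA_loss n lam b r q = (b - r) * q ^ m"
  proof -
    have "D * q ^ Suc m = (D * q) * q ^ m" by simp
    then show ?thesis
      unfolding n SPA_loss_Suc D_def[symmetric] by (simp add: Dq algebra_simps)
  qed
  have "SPA_loss n lam b r z \<le> SPA_loss n lam b r q" if "0 \<le> z" for z
    using interior_maximum[OF D Dq q(1) that]
    unfolding val by (simp add: n SPA_loss_Suc D_def)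
  from worst_regret_SPA_positive_reserve[OF _ assms(3,1) r(1) _ q this] assms(2) br
  have "worst_regret n a b lam (SPA a n r) = ereal (- (1 - lam) * b + (b - r) * q ^ m)"
    unfolding val by simp
  also have "(b - r) * q ^ m =
      (b - r) ^ n * (real n - 1) ^ (n - 1) / ((real n - 1 + lam) * (b - r) - r) ^ (n - 1)"
    by (simp add: n q_def D_def power_mult_distrib power_divide)
  finally show ?thesis .
qed

text \<open>Now \<open>D \<le> m * (b - r)\<close>, so the worst case is \<open>z = 1\<close>: all
  mass just below the reserve, nothing is sold, and the regret tends to
  \<open>lam * r\<close>.\<close>

lemma worst_regret_SPA_high_reserve:
  assumes "n \<ge> 1" and "0 < lam" and "0 \<le> a" and r: "a < r" "lam / (1 + lam) * b \<le> r" "r \<le> b"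
  shows "worst_regret n a b lam (SPA a n r) = ereal (lam * r)"
proof -
  obtain m where n: "n = Suc m" using assms(1) by (cases n) auto
  have D_le: "(real m + lam) * (b - r) - r \<le> real m * (b - r)"
    using r(2) assms(2) by (simp add: field_simps)
  have "SPA_loss n lam b r z \<le> SPA_loss n lam b r 1" if "0 \<le> z" "z \<le> 1" for z
    using boundary_maximum[OF D_le _ that] r(3) by (simp add: n SPA_loss_Suc)
  from worst_regret_SPA_positive_reserve[OF _ assms(3,1) r(1,3) _ _ this] assms(2)
  show ?thesis by (simp add: n SPA_loss_Suc algebra_simps)
qed

section \<open>The optimal reserve\<close>

text \<open>At \<open>z = n / (n + lam)\<close> the terms of \<open>SPA_loss\<close> that are linear in the reserve cancel.\<close>

lemma SPA_loss_reserve_independent: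
  assumes "n \<ge> 1" and "0 < lam"
  shows "SPA_loss n lam b r (real n / (real n + lam)) = (real n / (real n + lam)) ^ n * b"
proof -
  obtain m where n: "n = Suc m" using assms(1) by (cases n) auto
  define q where "q = real n / (real n + lam)"
  have eq: "(real n + lam) * q = real n" using assms by (simp add: q_def)
  have "real n * q ^ m = ((real n + lam) * q) * q ^ m" by (simp only: eq)
  also have "\<dots> = (real n + lam) * q ^ n" by (simp add: n)
  finally have "SPA_loss n lam b r q = (b - r) * ((real n + lam) * q ^ n - (real n - 1 + lam) * q ^ n) + r * q ^ n"
    by (simp add: SPA_loss_def n)
  then show ?thesis unfolding q_def[symmetric] by (simp add: algebra_simps)
qed

text \<open>A single \<open>z\<close> serves against every reserve above \<open>a\<close>, so the
  bound is free of \<open>r\<close>.\<close>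

lemma worst_regret_SPA_positive_reserve_ge:
  assumes "n \<ge> 1" and "0 < lam" and "a < r" "r \<le> b"
  shows "ereal (- (1 - lam) * b + (real n / (real n + lam)) ^ n * b)
    \<le> worst_regret n a b lam (SPA a n r)"
  using SPA_loss_le_worst_regret[of "real n / (real n + lam)" n a r b lam] assms
  by (simp add: SPA_loss_reserve_independent)

text \<open>This reserve gives \<open>D = (n - 1) * b\<close>, so for \<open>n > 1\<close> the
  stationary point of \<open>SPA_loss\<close> is exactly \<open>n / (n + lam)\<close>, where its
  value does not depend on the reserve.\<close>

lemma worst_regret_SPA_optimal_reserve:
  assumes n: "n \<ge> 1" and lam: "0 < lam" and "0 \<le> a" "a < b"
    and less: "a < lam / (real n + lam) * b"
  shows "worst_regret n a b lam (SPA a n (lam / (real n + lam) * b)) =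
    ereal (- (1 - lam) * b + (real n / (real n + lam)) ^ n * b)"
proof -
  obtain m where m: "n = Suc m" using n by (cases n) auto
  define r where "r = lam / (real n + lam) * b"
  have pos: "0 < real n + lam" "0 < b" using assms by simp_all
  have "lam / (real n + lam) \<le> lam / (1 + lam)"
    using n lam by (intro divide_left_mono) auto
  then have r_le: "r \<le> lam / (1 + lam) * b"
    unfolding r_def using pos by (intro mult_right_mono) auto
  have br: "b - r = real n / (real n + lam) * b"
    using pos by (simp add: r_def field_simps)
  have "(real n - 1 + lam) * (b - r) - r = b * ((real n - 1 + lam) * real n - lam) / (real n + lam)"
    unfolding br unfolding r_def by (simp add: add_divide_distrib diff_divide_distrib algebra_simps)
  also have "(real n - 1 + lam) * real n - lam = (real n - 1) * (real n + lam)"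
    by (simp add: algebra_simps)
  finally have D: "(real n - 1 + lam) * (b - r) - r = (real n - 1) * b"
    using pos by simp
  have "(b - r) ^ n * (real n - 1) ^ (n - 1) / ((real n - 1 + lam) * (b - r) - r) ^ (n - 1) =
      (real n / (real n + lam)) ^ n * b"
    unfolding D unfolding br using pos
    by (cases "m = 0") (simp_all add: m power_mult_distrib power_divide)
  then show ?thesis
    using worst_regret_SPA_low_reserve[OF n lam \<open>0 \<le> a\<close> less[folded r_def] r_le]
    unfolding r_def[symmetric] by simp
qed

theorem mainTheorem5:
  fixes n :: nat and lam a b :: real
  assumes "n \<ge> 1" and "0 < lam" and "lam \<le> 1" and "0 \<le> a" and "a < b"
  shows
    "(\<forall>r \<in> {a..b}.
        (r = a \<longrightarrow>
           worst_regret n a b lam (SPA a n r) =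
           ereal (- (1 - lam) * b
             + (b - a) * ((real n - 1) / (real n - 1 + lam)) ^ (n - 1))) \<and>
        (a < r \<and> r \<le> lam / (1 + lam) * b \<longrightarrow>
           worst_regret n a b lam (SPA a n r) =
           ereal (- (1 - lam) * b
             + (b - r) ^ n * (real n - 1) ^ (n - 1)
                 / ((real n - 1 + lam) * (b - r) - r) ^ (n - 1))) \<and>
        (a < r \<and> lam / (1 + lam) * b \<le> r \<longrightarrow>
           worst_regret n a b lam (SPA a n r) = ereal (lam * r)))
     \<and>
     (let threshold = 1 - (real n / (real n + lam)) ^ n
                           * ((real n - 1 + lam) / (real n - 1)) ^ (n - 1);
          opt = (INF r \<in> {a..b}. worst_regret n a b lam (SPA a n r))
      in
        (a / b \<le> threshold \<longrightarrow>
           opt = ereal (- (1 - lam) * b + (real n / (real n + lam)) ^ n * b) \<and>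
           lam / (real n + lam) * b \<in> {a..b} \<and>
           worst_regret n a b lam (SPA a n (lam / (real n + lam) * b)) = opt) \<and>
        (a / b \<ge> threshold \<longrightarrow>
           opt = ereal (- (1 - lam) * b
                   + ((real n - 1) / (real n - 1 + lam)) ^ (n - 1) * (b - a)) \<and>
           worst_regret n a b lam (SPA a n a) = opt))"
proof -
  note n = \<open>n \<ge> 1\<close> and lam = \<open>0 < lam\<close> and ab = \<open>0 \<le> a\<close> \<open>a < b\<close>
  define q where "q = real n / (real n + lam)"
  define z where "z = ((real n - 1) / (real n - 1 + lam)) ^ (n - 1)"
  define W where "W r = worst_regret n a b lam (SPA a n r)" for r
  define s where "s = lam / (real n + lam) * b"
  define V where "V = - (1 - lam) * b + q ^ n * b"
  define threshold where
    "threshold = 1 - q ^ n * ((real n - 1 + lam) / (real n - 1)) ^ (n - 1)"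
  define opt where "opt = (INF r \<in> {a..b}. W r)"
  have b: "0 < b" using ab by simp
  \<comment> \<open>For \<open>n = 1\<close> both bases are 0, one of them by division by zero, but
    the exponent 0 makes both powers 1.\<close>
  have z: "0 < z" and inv_z: "((real n - 1 + lam) / (real n - 1)) ^ (n - 1) = 1 / z"
    using n lam by (cases "n = 1"; simp add: z_def power_divide)+
  have W_a: "W a = ereal (- (1 - lam) * b + z * (b - a))"
    using worst_regret_SPA_a[OF n lam ab(2)] by (simp add: W_def z_def mult.commute)
  have W_ge: "ereal V \<le> W r" if "a < r" "r \<le> b" for r
    using worst_regret_SPA_positive_reserve_ge[OF n lam that] by (simp add: W_def V_def q_def)
  \<comment> \<open>The threshold equals \<open>1 - q ^ n / z\<close>; clearing \<open>b\<close> and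
    \<open>z\<close> compares the two candidate values.\<close>
  have threshold: "a / b \<le> threshold \<longleftrightarrow> q ^ n * b \<le> z * (b - a)"
    "threshold \<le> a / b \<longleftrightarrow> z * (b - a) \<le> q ^ n * b"
    unfolding threshold_def inv_z using b z by (simp_all add: field_simps)
  \<comment> \<open>The base of \<open>z\<close> is \<open>q\<close> with \<open>n - 1\<close> for
    \<open>n\<close>, hence smaller. This is what makes \<open>s\<close> an admissible reserve in
    the first case.\<close>
  have z_le: "z \<le> q ^ (n - 1)"
    unfolding z_def q_def using n lam by (intro power_mono) (simp_all add: field_simps)
  have s_eq: "b - s = q * b" and s_le: "s \<le> b"
    using lam b by (simp_all add: s_def q_def field_simps)
  have first: "opt = ereal V \<and> s \<in> {a..b} \<and> W s = opt" if "a / b \<le> threshold"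
  proof -
    have le: "q ^ n * b \<le> z * (b - a)" using that threshold by simp
    also have "\<dots> \<le> q ^ (n - 1) * (b - a)" using z_le ab by (intro mult_right_mono) auto
    finally have "q ^ (n - 1) * (q * b) \<le> q ^ (n - 1) * (b - a)"
      using n by (simp add: power_eq_if mult_ac)
    moreover have "0 < q ^ (n - 1)" using n lam by (simp add: q_def)
    ultimately have "q * b \<le> b - a" by simp
    then have s: "a \<le> s" using s_eq by simp
    have W_s: "W s = ereal V"
    proof (cases "s = a")
      case True
      have "z * (b - a) \<le> q ^ (n - 1) * (b - s)"
        unfolding True using z_le ab by (intro mult_right_mono) auto
      also have "\<dots> = q ^ n * b"
        using n by (simp add: s_eq power_eq_if)
      finally have "z * (b - a) = q ^ n * b" using le by simp
      then show ?thesis using W_a True by (simp add: V_def)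
    next
      case False
      then show ?thesis
        using worst_regret_SPA_optimal_reserve[OF n lam ab] s by (simp add: W_def V_def q_def s_def)
    qed
    have "ereal V \<le> W r" if "r \<in> {a..b}" for r
      using W_ge[of r] W_a le that by (cases "r = a") (auto simp: V_def)
    then have "opt = ereal V"
      unfolding opt_def using s s_le W_s
      by (intro antisym INF_greatest) (auto intro: INF_lower2[of s])
    then show ?thesis using s s_le W_s by simp
  qed
  have second: "opt = ereal (- (1 - lam) * b + z * (b - a)) \<and> W a = opt" if "threshold \<le> a / b"
  proof -
    \<comment> \<open>\<open>V\<close> separates reserve \<open>a\<close> from all larger reserves,
      whose worst-case regret is at least \<open>V\<close>.\<close>
    have "W a \<le> ereal V" using that threshold W_a by (simp add: V_def)
    then have "W a \<le> W r" if "r \<in> {a..b}" for r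
      using W_ge[of r] that by (cases "r = a") auto
    then have "opt = W a"
      unfolding opt_def using ab
      by (intro antisym INF_greatest) (auto intro: INF_lower2[of a])
    then show ?thesis using W_a by simp
  qed
  show ?thesis
    unfolding Let_def
  proof (intro conjI ballI impI, goal_cases)
    case (1 r)
    then show ?case using worst_regret_SPA_a[OF n lam ab(2)] by simp
  next
    case (2 r)
    then show ?case using worst_regret_SPA_low_reserve[OF n lam ab(1)] by simp
  next
    case (3 r)
    then show ?case using worst_regret_SPA_high_reserve[OF n lam ab(1)] by simp
  qed (use first second in \<open>unfold opt_def threshold_def V_def q_def z_def s_def W_def, simp_all\<close>)
qed

end
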